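(* Let $f_m(A)=Q_mT_m^{-1}Q_m^{\top}$ and $R_m=A^{-1}-f_m(A)$. Then: (i) $P_m^\perp f_m(A)=0$ and $P_m^\perp f_m(A)P_m^\perp=0$. (ii) The compression of $R_m$ to the unresolved subspace equals the complement block of $A^{-1}$: $$P_m^\perp R_mP_m^\perp=Q_{m,\perp}S_\perp^{-1}Q_{m,\perp}^{\top},\qquad \mathrm{tr}(P_m^\perp R_mP_m^\perp)=\mathrm{tr}(S_\perp^{-1}),$$ where $S_\perp=T_{m,\perp}-\gamma e_1e_1^{\top}$ and $\gamma=\beta_m^2(T_m^{-1})_{mm}$. (iii) Assume $d-m\ge2$. Excluding the direction $u=q_\perp/\|q_\perp\|_2$, which is retained exactly with variance $\sigma_u$, the isotropic bulk magnitude, i.e. the mean of the $d-m-1$ eigenvalues of the compression of $Q_{m,\perp}S_\perp^{-1}Q_{m,\perp}^{\top}$ to the orthogonal complement of $u$ in $\mathrm{range}(P_m^\perp)$, is $$\omega(m)=\frac{\mathrm{tr}(S_\perp^{-1})-\sigma_u}{d-m-1}.$$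
   Context: $A\in\mathbb{R}^{d\times d}$ is symmetric positive definite and $1\le m<d$. Starting from a unit vector $q_1=v_{\mathrm{ref}}/\|v_{\mathrm{ref}}\|_2$, $m$ steps of the Lanczos algorithm (exact arithmetic, no breakdown before step $m$) produce $Q_m=[q_1,\dots,q_m]\in\mathbb{R}^{d\times m}$ with orthonormal columns, a symmetric tridiagonal positive definite matrix $T_m=Q_m^{\top}AQ_m$, a scalar $\beta_m\ge0$, and a unit vector $q_{m+1}\perp\mathrm{range}(Q_m)$ (any such unit vector if $\beta_m=0$) with $AQ_m=Q_mT_m+\beta_mq_{m+1}e_m^{\top}$. $Q_{m,\perp}\in\mathbb{R}^{d\times(d-m)}$ has orthonormal columns spanning the orthogonal complement of $\mathrm{range}(Q_m)$, with first column $q_{m+1}$; $P_m^\perp=I_d-Q_mQ_m^{\top}$; $T_{m,\perp}=Q_{m,\perp}^{\top}AQ_{m,\perp}$. $e_1\in\mathbb{R}^{d-m}$ is the first coordinate vector. $S_\perp$ is symmetric positive definite (it is the Schur complement of $T_m$ in $A$). $q_\perp=Q_{m,\perp}S_\perp^{-1}e_1$ and $\sigma_u=u^{\top}(Q_{m,\perp}S_\perp^{-1}Q_{m,\perp}^{\top})u=\dfrac{e_1^{\top}S_\perp^{-3}e_1}{e_1^{\top}S_\perp^{-2}e_1}$. *)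

theory Defs
  imports
    Complex_Main
    "Jordan_Normal_Form.Char_Poly"
    "Jordan_Normal_Form.Gauss_Jordan_Elimination"
    "Jordan_Normal_Form.VS_Connect"
begin

definition vec_norm2 :: "real vec \<Rightarrow> real" where
  "vec_norm2 v = sqrt (v \<bullet> v)"

definition outer_prod :: "real vec \<Rightarrow> real vec \<Rightarrow> real mat" where
  "outer_prod v w = mat (dim_vec v) (dim_vec w) (\<lambda>(i, j). v $ i * w $ j)"

definition mat_trace :: "real mat \<Rightarrow> real" where
  "mat_trace M = (\<Sum>i<dim_row M. M $$ (i, i))"

text \<open>Meaningful only for invertible \<open>M\<close>: \<^const>\<open>mat_inverse\<close> is \<^const>\<open>None\<close> otherwise.\<close>

definition mat_inv :: "real mat \<Rightarrow> real mat" where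
  "mat_inv M = the (mat_inverse M)"

definition sym_pos_def :: "nat \<Rightarrow> real mat \<Rightarrow> bool" where
  "sym_pos_def n M \<longleftrightarrow> M \<in> carrier_mat n n \<and> M\<^sup>T = M \<and>
     (\<forall>x \<in> carrier_vec n. x \<noteq> 0\<^sub>v n \<longrightarrow> x \<bullet> (M *\<^sub>v x) > 0)"

abbreviation col_range :: "nat \<Rightarrow> real mat \<Rightarrow> real vec set" where
  "col_range n M \<equiv> vec_space.col_space n M"

abbreviation orth_compl :: "nat \<Rightarrow> real vec set \<Rightarrow> real vec set" where
  "orth_compl n W \<equiv> vec_module.orthogonal_complement n W"

definition orthonormal_basis_mat :: "nat \<Rightarrow> nat \<Rightarrow> real mat \<Rightarrow> real vec set \<Rightarrow> bool" where
  "orthonormal_basis_mat n k V W \<longleftrightarrow>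
     V \<in> carrier_mat n k \<and> V\<^sup>T * V = 1\<^sub>m k \<and> col_range n V = W"

text \<open>The real eigenvalues, counted with algebraic multiplicity.\<close>

definition eigenvalue_mset :: "real mat \<Rightarrow> real multiset" where
  "eigenvalue_mset M = proots (char_poly M)"

text \<open>
  The Lanczos iteration. With the vectors numbered \<open>q\<^sub>1, q\<^sub>2, \<dots>\<close>, the state after \<open>j\<close> steps is
  \<open>(q\<^sub>j, \<beta>\<^sub>j, q\<^sub>j\<^sub>+\<^sub>1)\<close>, where \<open>q\<^sub>0 = 0\<close> and \<open>\<beta>\<^sub>0 = 0\<close>. Step \<open>j + 1\<close> forms the residual
  \<open>w = A q\<^sub>j\<^sub>+\<^sub>1 - \<alpha> q\<^sub>j\<^sub>+\<^sub>1 - \<beta>\<^sub>j q\<^sub>j\<close> with \<open>\<alpha> = q\<^sub>j\<^sub>+\<^sub>1 \<bullet> A q\<^sub>j\<^sub>+\<^sub>1\<close>. It breaks down if \<open>\<beta>\<^sub>j\<^sub>+\<^sub>1 = \<parallel>w\<parallel> = 0\<close>;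
  the vectors produced from then on are zero and carry no meaning.
\<close>

primrec lanczos_state :: "real mat \<Rightarrow> real vec \<Rightarrow> nat \<Rightarrow> real vec \<times> real \<times> real vec" where
  "lanczos_state A v 0 = (0\<^sub>v (dim_vec v), 0, (1 / vec_norm2 v) \<cdot>\<^sub>v v)"
| "lanczos_state A v (Suc j) =
     (case lanczos_state A v j of (p, b, q) \<Rightarrow>
        let w = A *\<^sub>v q - (q \<bullet> (A *\<^sub>v q)) \<cdot>\<^sub>v q - b \<cdot>\<^sub>v p
        in (q, vec_norm2 w, (1 / vec_norm2 w) \<cdot>\<^sub>v w))"

text \<open>Vectors are indexed from 0 as columns are: \<open>lanczos_vec A v j\<close> is \<open>q\<^sub>j\<^sub>+\<^sub>1\<close>.\<close>

definition lanczos_vec :: "real mat \<Rightarrow> real vec \<Rightarrow> nat \<Rightarrow> real vec" where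
  "lanczos_vec A v j = snd (snd (lanczos_state A v j))"

definition lanczos_alpha :: "real mat \<Rightarrow> real vec \<Rightarrow> nat \<Rightarrow> real" where
  "lanczos_alpha A v j = lanczos_vec A v j \<bullet> (A *\<^sub>v lanczos_vec A v j)"

text \<open>\<open>lanczos_beta A v j\<close> is \<open>\<beta>\<^sub>j\<close>, which couples \<open>lanczos_vec A v (j - 1)\<close> and \<open>lanczos_vec A v j\<close>.\<close>

definition lanczos_beta :: "real mat \<Rightarrow> real vec \<Rightarrow> nat \<Rightarrow> real" where
  "lanczos_beta A v j = fst (snd (lanczos_state A v j))"

definition lanczos_Q :: "real mat \<Rightarrow> real vec \<Rightarrow> nat \<Rightarrow> real mat" where
  "lanczos_Q A v m = mat_of_cols (dim_vec v) (map (lanczos_vec A v) [0..<m])"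

definition lanczos_T :: "real mat \<Rightarrow> real vec \<Rightarrow> nat \<Rightarrow> real mat" where
  "lanczos_T A v m = mat m m (\<lambda>(i, j).
     if i = j then lanczos_alpha A v i
     else if j = Suc i then lanczos_beta A v j
     else if i = Suc j then lanczos_beta A v i
     else 0)"

definition lanczos_no_breakdown :: "real mat \<Rightarrow> real vec \<Rightarrow> nat \<Rightarrow> bool" where
  "lanczos_no_breakdown A v m \<longleftrightarrow> (\<forall>j. 1 \<le> j \<and> j < m \<longrightarrow> lanczos_beta A v j \<noteq> 0)"

text \<open>The admissible choices of \<open>q\<^sub>m\<^sub>+\<^sub>1\<close> after \<open>m\<close> steps; it is determined unless \<open>\<beta>\<^sub>m = 0\<close>.\<close>

definition lanczos_next :: "real mat \<Rightarrow> real vec \<Rightarrow> nat \<Rightarrow> real vec \<Rightarrow> bool" where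
  "lanczos_next A v m q \<longleftrightarrow>
     (if lanczos_beta A v m = 0
      then vec_norm2 q = 1 \<and> q \<in> orth_compl (dim_vec v) (col_range (dim_vec v) (lanczos_Q A v m))
      else q = lanczos_vec A v m)"

end

theory Submission
  imports Defs "Jordan_Normal_Form.Schur_Decomposition"
begin

text \<open>
  The three-term recurrence makes the Lanczos vectors orthonormal, so that \<open>T = Q\<^sup>T A Q\<close> and the
  coupling block \<open>Q\<^sub>\<bottom>\<^sup>T A Q\<close> is \<open>\<beta> e\<^sub>1 e\<^sub>m\<^sup>T\<close>. Hence \<open>S\<close> is the Schur complement of \<open>T\<close> in \<open>A\<close> written
  in the basis \<open>[Q, Q\<^sub>\<bottom>]\<close>, and its inverse is the block \<open>Q\<^sub>\<bottom>\<^sup>T A\<^sup>-\<^sup>1 Q\<^sub>\<bottom>\<close>. With \<open>u = Q\<^sub>\<bottom> y\<close>, an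
  orthonormal basis \<open>V\<close> of the complement of \<open>u\<close> satisfies \<open>V V\<^sup>T = P - u u\<^sup>T\<close>, so the compression
  has trace \<open>tr S\<^sup>-\<^sup>1 - y\<^sup>T S\<^sup>-\<^sup>1 y\<close>; being symmetric, it has real eigenvalues that sum to this trace.
\<close>

section \<open>Matrix algebra\<close>

text \<open>Conformability as equations between \<open>dim_row\<close> and \<open>dim_col\<close> is
  decided by rewriting, whereas a carrier premise mentions sizes that do not occur in the product.
  The other \<open>_dim\<close> rules have this form for the same reason.\<close>

lemma mult_assoc_dim:
  fixes A :: "'a::semiring_0 mat"
  assumes "dim_col A = dim_row B" "dim_col B = dim_row C"
  shows "A * B * C = A * (B * C)"
  using assms by (metis assoc_mult_mat carrier_matI)

lemma minus_mult_dim: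
  fixes A :: "'a::ring mat"
  assumes "dim_row A = dim_row B" "dim_col A = dim_col B" "dim_col B = dim_row C"
  shows "(A - B) * C = A * C - B * C"
  using assms by (metis minus_mult_distrib_mat carrier_matI)

lemma mult_minus_dim:
  fixes A :: "'a::ring mat"
  assumes "dim_row B = dim_row C" "dim_col B = dim_col C" "dim_col A = dim_row B"
  shows "A * (B - C) = A * B - A * C"
  using assms by (metis mult_minus_distrib_mat carrier_matI)

lemma transpose_mult_dim:
  fixes A :: "'a::comm_semiring_0 mat"
  assumes "dim_col A = dim_row B"
  shows "(A * B)\<^sup>T = B\<^sup>T * A\<^sup>T"
  using assms by (metis transpose_mult carrier_matI)

lemma transpose_minus_dim:
  fixes A :: "'a::ab_group_add mat"
  assumes "dim_row A = dim_row B" "dim_col A = dim_col B"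
  shows "(A - B)\<^sup>T = A\<^sup>T - B\<^sup>T"
  using assms by (intro eq_matI) auto

lemma mult_vec_assoc_dim:
  fixes A :: "'a::semiring_0 mat"
  assumes "dim_col A = dim_row B" "dim_col B = dim_vec v"
  shows "A * B *\<^sub>v v = A *\<^sub>v (B *\<^sub>v v)"
  using assms by (metis assoc_mult_mat_vec carrier_matI carrier_vecI)

lemma minus_mult_vec_dim:
  fixes A :: "'a::ring mat"
  assumes "dim_row A = dim_row B" "dim_col A = dim_col B" "dim_col B = dim_vec v"
  shows "(A - B) *\<^sub>v v = A *\<^sub>v v - B *\<^sub>v v"
  using assms by (metis minus_mult_distrib_mat_vec carrier_matI carrier_vecI)

lemmas mat_algebra_dim =
  mult_assoc_dim minus_mult_dim mult_minus_dim transpose_mult_dim transpose_minus_dim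
  mult_vec_assoc_dim minus_mult_vec_dim

lemma scalar_prod_mult_mat_vec:
  fixes A :: "'a::comm_semiring_0 mat"
  assumes "dim_vec x = dim_row A" "dim_vec y = dim_col A"
  shows "x \<bullet> (A *\<^sub>v y) = (A\<^sup>T *\<^sub>v x) \<bullet> y"
  using assms by (metis carrier_matI carrier_vecI transpose_vec_mult_scalar)

lemma mult_mat_vec_smult_dim:
  fixes A :: "'a::field mat"
  assumes "dim_col A = dim_vec v"
  shows "A *\<^sub>v (c \<cdot>\<^sub>v v) = c \<cdot>\<^sub>v (A *\<^sub>v v)"
  by (intro mult_mat_vec[of _ "dim_row A" "dim_col A"] carrier_matI carrier_vecI) (simp_all add: assms)

lemma mat_eq_by_vecI:
  assumes "A \<in> carrier_mat m n" "B \<in> carrier_mat m n"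
    and "\<And>x. x \<in> carrier_vec n \<Longrightarrow> A *\<^sub>v x = B *\<^sub>v (x :: 'a::semiring_1 vec)"
  shows "A = B"
proof (rule eq_matI)
  fix i j assume ij: "i < dim_row B" "j < dim_col B"
  have "A $$ (i, j) = (A *\<^sub>v unit_vec n j) $ i"
    using ij assms(1,2) by simp
  also have "\<dots> = (B *\<^sub>v unit_vec n j) $ i"
    using assms(3)[of "unit_vec n j"] by simp
  also have "\<dots> = B $$ (i, j)"
    using ij assms(2) by simp
  finally show "A $$ (i, j) = B $$ (i, j)" .
qed (use assms in auto)

lemma transpose_outer_prod [simp]: "(outer_prod v w)\<^sup>T = outer_prod w v"
  by (rule eq_matI) (auto simp: outer_prod_def)

lemma dim_outer_prod [simp]:
  "dim_row (outer_prod v w) = dim_vec v" "dim_col (outer_prod v w) = dim_vec w"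
  by (auto simp: outer_prod_def)

lemma mult_outer_prod:
  "dim_col A = dim_vec v \<Longrightarrow> A * outer_prod v w = outer_prod (A *\<^sub>v v) w"
  by (rule eq_matI)
    (auto simp: outer_prod_def scalar_prod_def sum_distrib_right mult.assoc)

lemma outer_prod_mult:
  "dim_row A = dim_vec w \<Longrightarrow> outer_prod v w * A = outer_prod v (A\<^sup>T *\<^sub>v w)"
  by (rule eq_matI) (auto simp: outer_prod_def scalar_prod_def sum_distrib_left ac_simps)

lemma outer_prod_mult_vec:
  "dim_vec x = dim_vec w \<Longrightarrow> outer_prod v w *\<^sub>v x = (w \<bullet> x) \<cdot>\<^sub>v v"
  by (rule eq_vecI) (auto simp: outer_prod_def scalar_prod_def sum_distrib_left ac_simps)

lemma outer_prod_smult: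
  "outer_prod (a \<cdot>\<^sub>v v) (b \<cdot>\<^sub>v w) = (a * b) \<cdot>\<^sub>m outer_prod v w"
  by (rule eq_matI) (auto simp: outer_prod_def)

section \<open>Traces and Euclidean norms\<close>

lemma mat_trace_comm:
  assumes "A \<in> carrier_mat m n" "B \<in> carrier_mat n m"
  shows "mat_trace (A * B) = mat_trace (B * A)"
proof -
  have "mat_trace (A * B) = (\<Sum>i<m. \<Sum>j<n. A $$ (i, j) * B $$ (j, i))"
    using assms by (auto simp: mat_trace_def scalar_prod_def lessThan_atLeast0 intro!: sum.cong)
  also have "\<dots> = (\<Sum>j<n. \<Sum>i<m. B $$ (j, i) * A $$ (i, j))"
    by (subst sum.swap) (simp add: mult.commute)
  also have "\<dots> = mat_trace (B * A)"
    using assms by (auto simp: mat_trace_def scalar_prod_def lessThan_atLeast0 intro!: sum.cong)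
  finally show ?thesis .
qed

lemma mat_trace_minus:
  assumes "A \<in> carrier_mat n n" "B \<in> carrier_mat n n"
  shows "mat_trace (A - B) = mat_trace A - mat_trace B"
  using assms by (auto simp: mat_trace_def sum_subtractf)

lemma mat_trace_outer_prod:
  "dim_vec v = dim_vec w \<Longrightarrow> mat_trace (outer_prod v w) = v \<bullet> w"
  by (auto simp: mat_trace_def outer_prod_def scalar_prod_def lessThan_atLeast0)

lemma scalar_prod_self_nonneg: "(v :: real vec) \<bullet> v \<ge> 0"
  by (auto simp: scalar_prod_def intro!: sum_nonneg)

lemma scalar_prod_self_eq_0_iff: "(v :: real vec) \<bullet> v = 0 \<longleftrightarrow> v = 0\<^sub>v (dim_vec v)"
proof
  assume "v \<bullet> v = 0"
  then show "v = 0\<^sub>v (dim_vec v)"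
    by (intro eq_vecI) (auto simp: scalar_prod_def sum_nonneg_eq_0_iff)
next
  assume "v = 0\<^sub>v (dim_vec v)"
  then show "v \<bullet> v = 0"
    by (metis carrier_vec_dim_vec scalar_prod_left_zero)
qed

lemma vec_norm2_eq_0_iff: "vec_norm2 v = 0 \<longleftrightarrow> v = 0\<^sub>v (dim_vec v)"
  by (simp add: vec_norm2_def scalar_prod_self_eq_0_iff)

lemma vec_norm2_square: "vec_norm2 v * vec_norm2 v = v \<bullet> v"
  by (simp add: vec_norm2_def scalar_prod_self_nonneg)

section \<open>Inverses and positive definiteness\<close>

text \<open>A one-sided inverse of a square matrix is two-sided, so \<open>A\<close> is a unit and
  \<open>mat_inverse\<close> returns a value; uniqueness of inverses identifies it with
  \<open>B\<close>.\<close>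

lemma mat_inv_eqI:
  assumes A: "A \<in> carrier_mat n n" and B: "B \<in> carrier_mat n n" and AB: "A * B = 1\<^sub>m n"
  shows "mat_inv A = B"
proof -
  have BA: "B * A = 1\<^sub>m n"
    using mat_mult_left_right_inverse[OF A B AB] .
  have "A \<in> Units (ring_mat TYPE(real) n ())"
    using A B AB BA by (auto simp: Units_def ring_mat_def)
  then obtain C where C: "mat_inverse A = Some C"
    using mat_inverse(1)[OF A, of "()"] by (cases "mat_inverse A") auto
  then have "A * C = 1\<^sub>m n" "C \<in> carrier_mat n n"
    using mat_inverse(2)[OF A C] by auto
  then have "B = C"
    using A B BA assoc_mult_mat[of B n n A n C n] by simp
  then show ?thesis
    by (simp add: mat_inv_def C)
qed

text \<open>A kernel vector would violate positivity, hence the determinant is nonzero. Transposing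
  \<open>B * A\<close> shows that the transpose of \<open>B\<close> inverts \<open>A\<close> as
  well, so \<open>B\<close> is symmetric. Substituting \<open>x = A y\<close> turns the quadratic
  form of \<open>B\<close> at \<open>x\<close> into that of \<open>A\<close> at
  \<open>y\<close>.\<close>

lemma sym_pos_def_inverse:
  assumes "sym_pos_def n A"
  obtains B where "B \<in> carrier_mat n n" "A * B = 1\<^sub>m n" "B * A = 1\<^sub>m n"
    "mat_inv A = B" "B\<^sup>T = B" "sym_pos_def n B"
proof -
  have A: "A \<in> carrier_mat n n" and sym: "A\<^sup>T = A"
    and pos: "\<And>x. x \<in> carrier_vec n \<Longrightarrow> x \<noteq> 0\<^sub>v n \<Longrightarrow> x \<bullet> (A *\<^sub>v x) > 0"
    using assms by (auto simp: sym_pos_def_def)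
  have "det A \<noteq> 0"
  proof
    assume "det A = 0"
    then obtain v where v: "v \<in> carrier_vec n" "v \<noteq> 0\<^sub>v n" "A *\<^sub>v v = 0\<^sub>v n"
      using det_0_iff_vec_prod_zero[OF A] by auto
    with pos[of v] show False by simp
  qed
  then have "A \<in> Units (ring_mat TYPE(real) n ())"
    using det_non_zero_imp_unit[OF A, of "()"] by blast
  then obtain B where "mat_inverse A = Some B"
    using mat_inverse(1)[OF A, of "()"] by (cases "mat_inverse A") auto
  then have B: "B \<in> carrier_mat n n" "A * B = 1\<^sub>m n" "B * A = 1\<^sub>m n" "mat_inv A = B"
    using mat_inverse(2)[OF A] by (auto simp: mat_inv_def)
  have "A * B\<^sup>T = (B * A)\<^sup>T"
    using A B(1) sym by (simp add: transpose_mult_dim)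
  then have "mat_inv A = B\<^sup>T"
    using A B by (intro mat_inv_eqI[of _ n]) auto
  then have sB: "B\<^sup>T = B"
    using B by simp
  have "x \<bullet> (B *\<^sub>v x) > 0" if x: "x \<in> carrier_vec n" "x \<noteq> 0\<^sub>v n" for x
  proof -
    define y where "y = B *\<^sub>v x"
    have y: "y \<in> carrier_vec n" and xy: "A *\<^sub>v y = x"
      using x B A by (auto simp: y_def assoc_mult_mat_vec[symmetric])
    with x A have "y \<noteq> 0\<^sub>v n" by auto
    have "x \<bullet> (B *\<^sub>v x) = y \<bullet> (A *\<^sub>v y)"
      using x y by (simp add: xy y_def[symmetric] comm_scalar_prod[of x n])
    then show ?thesis
      using pos[OF y \<open>y \<noteq> 0\<^sub>v n\<close>] by simp
  qed
  then have "sym_pos_def n B"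
    using B sB by (auto simp: sym_pos_def_def)
  with B sB that show thesis by blast
qed

text \<open>Orthonormal columns make \<open>V\<close> injective, so a nonzero \<open>x\<close> gives
  a nonzero \<open>V x\<close>, at which the form of \<open>A\<close> is positive.\<close>

lemma sym_pos_def_compression:
  assumes A: "sym_pos_def n A" and V: "V \<in> carrier_mat n k" "V\<^sup>T * V = 1\<^sub>m k"
  shows "sym_pos_def k (V\<^sup>T * A * V)"
proof -
  have Ac: "A \<in> carrier_mat n n" and sym: "A\<^sup>T = A"
    and pos: "\<And>x. x \<in> carrier_vec n \<Longrightarrow> x \<noteq> 0\<^sub>v n \<Longrightarrow> x \<bullet> (A *\<^sub>v x) > 0"
    using A by (auto simp: sym_pos_def_def)
  have dims [simp]: "dim_row A = n" "dim_col A = n" "dim_row V = n" "dim_col V = k"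
    using Ac V by auto
  have "x \<bullet> (V\<^sup>T * A * V *\<^sub>v x) > 0" if x: "x \<in> carrier_vec k" "x \<noteq> 0\<^sub>v k" for x
  proof -
    have "V\<^sup>T *\<^sub>v (V *\<^sub>v x) = x"
      using V x by (simp flip: mult_vec_assoc_dim)
    moreover have "V\<^sup>T *\<^sub>v 0\<^sub>v n = 0\<^sub>v k"
      using V by (intro eq_vecI) auto
    ultimately have "V *\<^sub>v x \<noteq> 0\<^sub>v n"
      using x by metis
    then have "(V *\<^sub>v x) \<bullet> (A *\<^sub>v (V *\<^sub>v x)) > 0"
      using x by (intro pos carrier_vecI) auto
    then show ?thesis
      using x by (simp add: mult_vec_assoc_dim scalar_prod_mult_mat_vec[of x "V\<^sup>T"])
  qed
  then show ?thesis
    using sym by (auto simp: sym_pos_def_def mat_algebra_dim intro: carrier_matI)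
qed

section \<open>Eigenvalues of symmetric matrices\<close>

text \<open>Since the matrix is real and symmetric, it can be moved across the Hermitian product of
  an eigenvector with itself. This gives both \<open>a\<close> and \<open>cnj a\<close> as factor of
  the same nonzero number.\<close>

lemma real_symmetric_eigenvalue_Reals:
  fixes N :: "real mat"
  assumes N: "N \<in> carrier_mat n n" and sym: "N\<^sup>T = N"
    and ev: "eigenvalue (map_mat complex_of_real N) a"
  shows "a \<in> \<real>"
proof -
  define C where "C = map_mat complex_of_real N"
  have C: "C \<in> carrier_mat n n" and Csym: "C\<^sup>T = C"
    using N by (auto simp: C_def map_mat_transpose sym)
  obtain v where v: "v \<in> carrier_vec n" "v \<noteq> 0\<^sub>v n" "C *\<^sub>v v = a \<cdot>\<^sub>v v"
    using ev C by (auto simp: eigenvalue_def eigenvector_def C_def[symmetric])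
  have conjC: "conjugate (C *\<^sub>v v) = C *\<^sub>v conjugate v"
    using C v(1) N by (intro eq_vecI) (auto simp: C_def scalar_prod_def)
  have "a * (v \<bullet>c v) = (C *\<^sub>v v) \<bullet>c v"
    using v by simp
  also have "\<dots> = v \<bullet> (C *\<^sub>v conjugate v)"
    using C v by (simp add: scalar_prod_mult_mat_vec Csym)
  also have "\<dots> = cnj a * (v \<bullet>c v)"
    using v by (simp add: conjC[symmetric] conjugate_smult_vec)
  finally have "a = cnj a"
    using v by (metis conjugate_square_eq_0_vec mult_right_cancel)
  then show ?thesis
    by (metis Reals_cnj_iff)
qed

text \<open>The factorization exists over the complex numbers, its roots are real, and embedding the
  coefficients is injective, so the factorization descends to the reals.\<close>

lemma char_poly_real_symmetric_splits:
  fixes N :: "real mat"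
  assumes N: "N \<in> carrier_mat n n" and sym: "N\<^sup>T = N"
  obtains es where "char_poly N = (\<Prod>e\<leftarrow>es. [:- e, 1:])" "length es = n"
proof -
  define C where "C = map_mat complex_of_real N"
  have C: "C \<in> carrier_mat n n"
    using N by (auto simp: C_def)
  obtain as where as: "char_poly C = (\<Prod>a\<leftarrow>as. [:- a, 1:])" "length as = n"
    using char_poly_factorized[OF C] by blast
  have "a \<in> \<real>" if "a \<in> set as" for a
  proof -
    have "poly (char_poly C) a = 0"
      using that by (auto simp: as poly_prod_list prod_list_zero_iff)
    then have "eigenvalue C a"
      using eigenvalue_root_char_poly[OF C] by blast
    then show ?thesis
      using real_symmetric_eigenvalue_Reals[OF N sym] by (simp add: C_def)
  qed
  then have re: "complex_of_real (Re a) = a" if "a \<in> set as" for a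
    using that by (auto simp: Reals_def)
  define es where "es = map Re as"
  interpret mp: map_poly_inj_idom_hom complex_of_real ..
  have "map_poly complex_of_real (char_poly N) = (\<Prod>a\<leftarrow>as. [:- a, 1:])"
    using of_real_hom.char_poly_hom[OF N, where 'a = complex] as by (simp add: C_def)
  also have "\<dots> = map_poly complex_of_real (\<Prod>e\<leftarrow>es. [:- e, 1:])"
    by (simp add: es_def o_def mp.hom_prod_list re cong: map_cong)
  finally have "char_poly N = (\<Prod>e\<leftarrow>es. [:- e, 1:])"
    by simp
  moreover have "length es = n"
    using as by (simp add: es_def)
  ultimately show thesis
    using that by blast
qed

text \<open>\<open>proots\<close> collects real roots only; it has \<open>n\<close> elements because
  the polynomial splits over the reals. A Schur decomposition carries these roots on its diagonal,
  and the trace is invariant under similarity.\<close>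

lemma eigenvalue_mset_symmetric:
  fixes N :: "real mat"
  assumes N: "N \<in> carrier_mat n n" and sym: "N\<^sup>T = N"
  shows "size (eigenvalue_mset N) = n" "sum_mset (eigenvalue_mset N) = mat_trace N"
proof -
  obtain es where es: "char_poly N = (\<Prod>e\<leftarrow>es. [:- e, 1:])" "length es = n"
    using char_poly_real_symmetric_splits[OF N sym] .
  have ev: "eigenvalue_mset N = mset es"
    unfolding eigenvalue_mset_def es(1)
  proof (induction es)
    case (Cons e es)
    have "(\<Prod>e\<leftarrow>es. [:- e, 1:]) \<noteq> 0"
      by (auto simp: prod_list_zero_iff)
    then show ?case
      using Cons by (simp add: proots_mult del: mult_pCons_left)
  qed auto
  obtain B P Q where "schur_decomposition N es = (B, P, Q)"
    by (cases "schur_decomposition N es")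
  then have wit: "similar_mat_wit N B P Q" and diag: "diag_mat B = es"
    using schur_decomposition[OF N es(1)] by auto
  have c: "B \<in> carrier_mat n n" "P \<in> carrier_mat n n" "Q \<in> carrier_mat n n"
    and QP: "Q * P = 1\<^sub>m n" and N_eq: "N = P * B * Q"
    using similar_mat_witD2[OF N wit] by auto
  have "mat_trace N = mat_trace (Q * (P * B))"
    unfolding N_eq using c by (intro mat_trace_comm[of _ n n]) auto
  also have "Q * (P * B) = B"
    using c QP assoc_mult_mat[of Q n n P n B n] by simp
  also have "mat_trace B = sum_list es"
    using c by (simp add: mat_trace_def diag[symmetric] diag_mat_def interv_sum_list_conv_sum_set_nat
        lessThan_atLeast0)
  finally show "size (eigenvalue_mset N) = n" "sum_mset (eigenvalue_mset N) = mat_trace N"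
    by (simp_all only: ev es(2) size_mset sum_mset_sum_list)
qed

section \<open>Orthonormal bases\<close>

lemma mem_col_range_iff:
  assumes "V \<in> carrier_mat n k"
  shows "w \<in> col_range n V \<longleftrightarrow> (\<exists>x\<in>carrier_vec k. w = V *\<^sub>v x)"
  using assms by (auto simp: vec_space.col_space_eq)

lemma orthonormal_cancel:
  fixes V :: "'a::semiring_1 mat"
  assumes "V \<in> carrier_mat n k" "V\<^sup>T * V = 1\<^sub>m k" "x \<in> carrier_vec k"
  shows "V\<^sup>T *\<^sub>v (V *\<^sub>v x) = x"
proof -
  have "V\<^sup>T *\<^sub>v (V *\<^sub>v x) = (V\<^sup>T * V) *\<^sub>v x"
    using assms by (intro mult_vec_assoc_dim[symmetric]) auto
  then show ?thesis
    using assms by simp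
qed

lemma orthonormal_basis_mat_project:
  assumes "orthonormal_basis_mat n k V W" "w \<in> W"
  shows "V *\<^sub>v (V\<^sup>T *\<^sub>v w) = w"
proof -
  have V: "V \<in> carrier_mat n k" "V\<^sup>T * V = 1\<^sub>m k"
    using assms by (auto simp: orthonormal_basis_mat_def)
  obtain x where x: "x \<in> carrier_vec k" "w = V *\<^sub>v x"
    using assms mem_col_range_iff[OF V(1)] by (auto simp: orthonormal_basis_mat_def)
  then have "V\<^sup>T *\<^sub>v w = x"
    using V by (simp flip: mult_vec_assoc_dim)
  then show ?thesis
    using x by simp
qed

text \<open>Columns \<open>2, \<dots>, k\<close> of the Householder reflection that exchanges \<open>e\<^sub>1\<close> and \<open>y\<close>. For
  \<open>y = e\<^sub>1\<close> the factor \<open>2 / (v \<bullet> v)\<close> is \<open>2 / 0 = 0\<close> and the reflection is the identity.\<close>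

lemma ex_orthonormal_complement:
  fixes y :: "real vec"
  assumes y: "y \<in> carrier_vec k" "y \<bullet> y = 1" and k: "0 < k"
  obtains Z where "Z \<in> carrier_mat k (k - 1)" "Z\<^sup>T * Z = 1\<^sub>m (k - 1)"
    "Z * Z\<^sup>T = 1\<^sub>m k - outer_prod y y"
proof -
  define e :: "real vec" where "e = unit_vec k 0"
  define v where "v = y - e"
  define c where "c = 2 / (v \<bullet> v)"
  define H where "H = 1\<^sub>m k - outer_prod (c \<cdot>\<^sub>v v) v"
  have dims [simp]: "dim_vec y = k" "dim_vec e = k" "dim_vec v = k" "dim_row H = k" "dim_col H = k"
    using y by (auto simp: v_def e_def H_def)
  have e: "e \<in> carrier_vec k" "e \<bullet> e = 1"
    using k by (auto simp: e_def)
  have v: "v \<in> carrier_vec k"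
    by (auto intro: carrier_vecI)
  have ve: "v \<bullet> e = y \<bullet> e - 1"
    using y e by (simp add: v_def minus_scalar_prod_distrib[of _ k])
  \<comment> \<open>Both \<open>y\<close> and \<open>e\<close> are unit vectors. This value of
    \<open>v \<bullet> v\<close> is what makes the reflection send \<open>e\<close> exactly to
    \<open>y\<close>.\<close>
  have vv: "v \<bullet> v = - 2 * (v \<bullet> e)"
    using y e by (simp add: ve) (simp add: v_def minus_scalar_prod_distrib[of _ k]
        scalar_prod_minus_distrib[of _ k] comm_scalar_prod[of e k y])
  have symH: "H\<^sup>T = H"
    by (rule eq_matI) (auto simp: H_def outer_prod_def)
  have He: "H *\<^sub>v e = y"
  proof (cases "v = 0\<^sub>v k")
    case True
    have "y = e"
    proof (rule eq_vecI)
      fix i assume "i < dim_vec e"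
      then have "v $ i = 0" using True by simp
      then show "y $ i = e $ i" using \<open>i < dim_vec e\<close> by (simp add: v_def)
    qed simp
    moreover have "H = 1\<^sub>m k"
      by (rule eq_matI) (auto simp: H_def True outer_prod_def)
    ultimately show ?thesis using e by simp
  next
    case False
    then have "v \<bullet> v \<noteq> 0"
      by (simp add: scalar_prod_self_eq_0_iff)
    then have "c * (v \<bullet> e) = -1"
      by (simp add: c_def vv field_simps)
    moreover have "H *\<^sub>v e = e - (c * (v \<bullet> e)) \<cdot>\<^sub>v v"
      using e by (auto simp: H_def minus_mult_vec_dim outer_prod_mult_vec)
    ultimately show ?thesis
      using y by (auto simp: v_def intro!: eq_vecI)
  qed
  have HH: "H * H = 1\<^sub>m k"
  proof -
    \<comment> \<open>This also holds for \<open>v = 0\<close>, where \<open>c = 0\<close>. It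
      yields \<open>K * K = 2 K\<close>, and therefore \<open>(1 - K)\<close> squares to the
      identity.\<close>
    have c2: "c * c * (v \<bullet> v) = 2 * c"
      by (simp add: c_def)
    define K where "K = outer_prod (c \<cdot>\<^sub>v v) v"
    have [simp]: "dim_row K = k" "dim_col K = k"
      by (auto simp: K_def)
    have KK: "K * K = outer_prod ((c * c * (v \<bullet> v)) \<cdot>\<^sub>v v) v"
      by (auto simp: K_def mult_outer_prod outer_prod_mult_vec smult_smult_assoc mult_ac)
    have "H * H = 1\<^sub>m k - K - (K - K * K)"
      by (simp add: H_def K_def[symmetric] minus_mult_dim mult_minus_dim left_mult_one_mat'
          right_mult_one_mat')
    also have "\<dots> = 1\<^sub>m k"
      unfolding KK c2 by (rule eq_matI) (auto simp: K_def outer_prod_def)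
    finally show ?thesis .
  qed
  \<comment> \<open>The columns of \<open>E\<close> are the unit vectors other than
    \<open>e\<close>, so \<open>H * E\<close> is \<open>H\<close> without its first column
    \<open>y\<close>. Conjugating \<open>1 - e e^T\<close> by \<open>H\<close> gives
    \<open>1 - y y^T\<close>.\<close>
  define E :: "real mat" where "E = mat k (k - 1) (\<lambda>(i, j). if i = Suc j then 1 else 0)"
  have dimE [simp]: "dim_row E = k" "dim_col E = k - 1"
    by (auto simp: E_def)
  have EtE: "E\<^sup>T * E = 1\<^sub>m (k - 1)"
  proof (rule eq_matI)
    fix i j assume "i < dim_row (1\<^sub>m (k - 1) :: real mat)" "j < dim_col (1\<^sub>m (k - 1) :: real mat)"
    then have ij: "i < k - 1" "j < k - 1"
      by auto
    then have "(E\<^sup>T * E) $$ (i, j) =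
        (\<Sum>l<k. (if l = Suc i then 1 else 0) * (if l = Suc j then 1 else 0))"
      by (simp add: E_def scalar_prod_def lessThan_atLeast0)
    also have "\<dots> = (\<Sum>l<k. if l = Suc j then if i = j then 1 else 0 else 0)"
      by (intro sum.cong) auto
    finally have "(E\<^sup>T * E) $$ (i, j) =
        (\<Sum>l<k. if l = Suc j then if i = j then 1 else 0 else 0)" .
    moreover have "Suc j < k"
      using ij by simp
    ultimately show "(E\<^sup>T * E) $$ (i, j) = 1\<^sub>m (k - 1) $$ (i, j)"
      using ij by simp
  qed auto
  have EEt: "E * E\<^sup>T = 1\<^sub>m k - outer_prod e e"
  proof (rule eq_matI)
    fix i j assume ij: "i < dim_row (1\<^sub>m k - outer_prod e e)" "j < dim_col (1\<^sub>m k - outer_prod e e)"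
    then have "(E * E\<^sup>T) $$ (i, j) = (\<Sum>l<k - 1. if i = Suc l \<and> j = Suc l then 1 else 0)"
      by (auto simp: E_def scalar_prod_def lessThan_atLeast0 intro!: sum.cong)
    also have "\<dots> = (if i = j \<and> i \<noteq> 0 then 1 else 0)"
    proof (cases i)
      case (Suc l)
      have "(\<Sum>l<k - 1. if i = Suc l \<and> j = Suc l then 1 else 0 :: real) =
          (\<Sum>n<k - 1. if n = l then if i = j then 1 else 0 else 0)"
        by (intro sum.cong) (auto simp: Suc)
      moreover have "l < k - 1"
        using ij Suc by simp
      ultimately show ?thesis
        using Suc by simp
    qed simp
    finally show "(E * E\<^sup>T) $$ (i, j) = (1\<^sub>m k - outer_prod e e) $$ (i, j)"
      using ij by (auto simp: e_def outer_prod_def)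
  qed auto
  have cancel: "H * (H * X) = X" if "dim_row X = k" for X
    using that HH by (metis mult_assoc_dim left_mult_one_mat carrier_matI dims(4,5))
  show thesis
  proof (rule that[of "H * E"])
    show "H * E \<in> carrier_mat k (k - 1)"
      by (auto intro: carrier_matI)
    show "(H * E)\<^sup>T * (H * E) = 1\<^sub>m (k - 1)"
      by (simp add: mat_algebra_dim symH cancel EtE)
    have "(H * E) * (H * E)\<^sup>T = H * ((E * E\<^sup>T) * H)"
      by (simp add: mat_algebra_dim symH)
    also have "\<dots> = 1\<^sub>m k - outer_prod y y"
      unfolding EEt by (simp add: minus_mult_dim mult_minus_dim outer_prod_mult symH He
          mult_outer_prod HH left_mult_one_mat'[of H])
    finally show "(H * E) * (H * E)\<^sup>T = 1\<^sub>m k - outer_prod y y" .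
  qed
qed

section \<open>The Lanczos vectors\<close>

text \<open>Names the first component of the state. The zero vector at index 0 is the convention
  \<open>q\<^sub>0 = 0\<close>, under which one recurrence covers the first step too.\<close>

definition lanczos_prev :: "real mat \<Rightarrow> real vec \<Rightarrow> nat \<Rightarrow> real vec" where
  "lanczos_prev A v j = (case j of 0 \<Rightarrow> 0\<^sub>v (dim_vec v) | Suc i \<Rightarrow> lanczos_vec A v i)"

lemma lanczos_prev_simps [simp]:
  "lanczos_prev A v 0 = 0\<^sub>v (dim_vec v)" "lanczos_prev A v (Suc j) = lanczos_vec A v j"
  by (simp_all add: lanczos_prev_def)

lemma lanczos_state_eq:
  "lanczos_state A v j = (lanczos_prev A v j, lanczos_beta A v j, lanczos_vec A v j)"
  by (cases j) (auto simp: lanczos_beta_def lanczos_vec_def Let_def split: prod.splits)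

definition lanczos_residual :: "real mat \<Rightarrow> real vec \<Rightarrow> nat \<Rightarrow> real vec" where
  "lanczos_residual A v j = A *\<^sub>v lanczos_vec A v j
     - lanczos_alpha A v j \<cdot>\<^sub>v lanczos_vec A v j - lanczos_beta A v j \<cdot>\<^sub>v lanczos_prev A v j"

lemma lanczos_Suc:
  "lanczos_beta A v (Suc j) = vec_norm2 (lanczos_residual A v j)"
  "lanczos_vec A v (Suc j) = (1 / lanczos_beta A v (Suc j)) \<cdot>\<^sub>v lanczos_residual A v j"
  by (simp_all add: lanczos_beta_def[of _ _ "Suc j"] lanczos_vec_def[of _ _ "Suc j"]
      lanczos_residual_def lanczos_alpha_def lanczos_state_eq[of A v j] Let_def)

lemma lanczos_beta_0 [simp]: "lanczos_beta A v 0 = 0"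
  by (simp add: lanczos_beta_def)

lemma lanczos_vec_0: "lanczos_vec A v 0 = (1 / vec_norm2 v) \<cdot>\<^sub>v v"
  by (simp add: lanczos_vec_def)

context
  fixes A :: "real mat" and v :: "real vec" and d :: nat
  assumes A: "A \<in> carrier_mat d d" and v: "v \<in> carrier_vec d"
begin

lemma lanczos_vec_carrier [simp]: "lanczos_vec A v j \<in> carrier_vec d"
proof -
  have "lanczos_prev A v j \<in> carrier_vec d \<and> lanczos_vec A v j \<in> carrier_vec d"
    using A v by (induction j)
      (auto simp: lanczos_vec_0 lanczos_Suc(2) lanczos_residual_def intro!: carrier_vecI)
  then show ?thesis ..
qed

lemma lanczos_prev_carrier [simp]: "lanczos_prev A v j \<in> carrier_vec d"
  using v by (cases j) auto

lemma dim_lanczos [simp]: "dim_vec (lanczos_vec A v j) = d" "dim_vec (lanczos_prev A v j) = d"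
  using lanczos_vec_carrier lanczos_prev_carrier by (metis carrier_vecD)+

lemma lanczos_residual_carrier [simp]: "lanczos_residual A v j \<in> carrier_vec d"
  by (auto simp: lanczos_residual_def intro: carrier_vecI)

text \<open>Undoing the normalization is sound even at breakdown: \<open>lanczos_beta\<close> is the
  norm of the residual, so if it vanishes, the residual and the last summand are both zero. This
  covers a vanishing final coefficient.\<close>

lemma lanczos_recurrence:
  "A *\<^sub>v lanczos_vec A v j = lanczos_alpha A v j \<cdot>\<^sub>v lanczos_vec A v j
     + lanczos_beta A v j \<cdot>\<^sub>v lanczos_prev A v j
     + lanczos_beta A v (Suc j) \<cdot>\<^sub>v lanczos_vec A v (Suc j)"
proof -
  have "lanczos_beta A v (Suc j) \<cdot>\<^sub>v lanczos_vec A v (Suc j) = lanczos_residual A v j"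
  proof (cases "lanczos_beta A v (Suc j) = 0")
    case True
    then have "lanczos_residual A v j = 0\<^sub>v d"
      using lanczos_residual_carrier[of j] by (simp add: lanczos_Suc(1) vec_norm2_eq_0_iff)
    then show ?thesis
      using True by (auto intro!: eq_vecI)
  next
    case False
    then show ?thesis
      by (simp add: lanczos_Suc(2) smult_smult_assoc)
  qed
  then show ?thesis
    unfolding lanczos_residual_def using A by (auto intro!: eq_vecI)
qed

lemma scalar_prod_lanczos_recurrence:
  assumes "x \<in> carrier_vec d"
  shows "x \<bullet> (A *\<^sub>v lanczos_vec A v j) = lanczos_alpha A v j * (x \<bullet> lanczos_vec A v j)
     + lanczos_beta A v j * (x \<bullet> lanczos_prev A v j)
     + lanczos_beta A v (Suc j) * (x \<bullet> lanczos_vec A v (Suc j))"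
  using assms by (simp add: lanczos_recurrence scalar_prod_add_distrib[of _ d])

text \<open>For \<open>i = j\<close> the choice of \<open>lanczos_alpha\<close> cancels the
  component. For \<open>i < j\<close>, symmetry moves \<open>A\<close> onto vector \<open>i\<close>,
  whose recurrence reaches vector \<open>j\<close> only if \<open>Suc i = j\<close>; that
  contribution is the one subtracted with the previous vector. The factor
  \<open>lanczos_beta\<close> keeps the claim true at breakdown.\<close>

lemma lanczos_vec_orthogonal_next:
  assumes sym: "A\<^sup>T = A"
    and orth: "\<And>i k. i \<le> j \<Longrightarrow> k \<le> j \<Longrightarrow>
      lanczos_vec A v i \<bullet> lanczos_vec A v k = (if i = k then 1 else 0)"
    and i: "i \<le> j"
  shows "lanczos_beta A v (Suc j) * (lanczos_vec A v i \<bullet> lanczos_vec A v (Suc j)) = 0"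
proof (cases "i = j")
  case True
  have "lanczos_beta A v j * (lanczos_vec A v j \<bullet> lanczos_prev A v j) = 0"
    using orth by (cases j) auto
  then show ?thesis
    using scalar_prod_lanczos_recurrence[of "lanczos_vec A v j" j] orth[of j j] True
    by (simp add: lanczos_alpha_def del: mult_eq_0_iff)
next
  case False
  then obtain l where l: "j = Suc l"
    using i by (cases j) auto
  have "lanczos_vec A v i \<bullet> (A *\<^sub>v lanczos_vec A v j) = lanczos_vec A v j \<bullet> (A *\<^sub>v lanczos_vec A v i)"
    using A comm_scalar_prod[of "A *\<^sub>v lanczos_vec A v i" d "lanczos_vec A v j"]
    by (simp add: scalar_prod_mult_mat_vec[of "lanczos_vec A v i" A] sym)
  also have "\<dots> = (if Suc i = j then lanczos_beta A v j else 0)"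
  proof -
    have "lanczos_vec A v j \<bullet> lanczos_prev A v i = 0"
      using orth[of j "i - 1"] i False v by (cases i) auto
    then show ?thesis
      using scalar_prod_lanczos_recurrence[of "lanczos_vec A v j" i] orth[of j i] orth[of j "Suc i"]
        i False by auto
  qed
  finally have "lanczos_vec A v i \<bullet> (A *\<^sub>v lanczos_vec A v j) = (if i = l then lanczos_beta A v j else 0)"
    by (simp add: l)
  moreover have "lanczos_vec A v i \<bullet> lanczos_vec A v j = 0"
    "lanczos_vec A v i \<bullet> lanczos_prev A v j = (if i = l then 1 else 0)"
    using orth[of i j] orth[of i l] i False by (simp_all add: l)
  ultimately show ?thesis
    using scalar_prod_lanczos_recurrence[of "lanczos_vec A v i" j]
    by (simp del: mult_eq_0_iff split: if_splits)
qed

text \<open>Induction on the last index: a nonzero coefficient can be cancelled from the preceding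
  orthogonality relation, and dividing the residual by its norm gives length 1.\<close>

lemma lanczos_vec_orthonormal:
  assumes sym: "A\<^sup>T = A" and v0: "v \<noteq> 0\<^sub>v d"
    and nb: "\<And>l. 1 \<le> l \<Longrightarrow> l \<le> j \<Longrightarrow> lanczos_beta A v l \<noteq> 0"
    and "i \<le> j" "k \<le> j"
  shows "lanczos_vec A v i \<bullet> lanczos_vec A v k = (if i = k then 1 else 0)"
  using nb assms(4,5)
proof (induction j arbitrary: i k)
  case 0
  have "v \<bullet> v \<noteq> 0" "vec_norm2 v \<noteq> 0"
    using v v0 by (auto simp: vec_norm2_eq_0_iff scalar_prod_self_eq_0_iff)
  then show ?case
    using 0 by (simp add: lanczos_vec_0 vec_norm2_square)
next
  case (Suc j)
  have IH: "lanczos_vec A v i \<bullet> lanczos_vec A v k = (if i = k then 1 else 0)"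
    if "i \<le> j" "k \<le> j" for i k
    using Suc that by auto
  have nz: "lanczos_beta A v (Suc j) \<noteq> 0"
    using Suc.prems by auto
  then have "lanczos_vec A v i \<bullet> lanczos_vec A v (Suc j) = 0" if "i \<le> j" for i
    using lanczos_vec_orthogonal_next[OF sym IH that] by simp
  moreover from this have "lanczos_vec A v (Suc j) \<bullet> lanczos_vec A v i = 0" if "i \<le> j" for i
    using that by (simp add: comm_scalar_prod[of "lanczos_vec A v (Suc j)" d])
  moreover have "lanczos_vec A v (Suc j) \<bullet> lanczos_vec A v (Suc j) = 1"
    using nz by (simp add: lanczos_Suc vec_norm2_eq_0_iff vec_norm2_square scalar_prod_self_eq_0_iff)
  ultimately show ?case
    using Suc.prems IH by (auto simp: le_Suc_eq)
qed

section \<open>The Lanczos relation in matrix form\<close>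

lemma lanczos_Q_carrier: "lanczos_Q A v m \<in> carrier_mat d m"
  using v by (auto simp: lanczos_Q_def intro!: carrier_matI)

lemma col_lanczos_Q: "j < m \<Longrightarrow> col (lanczos_Q A v m) j = lanczos_vec A v j"
  using v by (simp add: lanczos_Q_def)

context
  fixes m :: nat
  assumes sym: "A\<^sup>T = A" and v0: "v \<noteq> 0\<^sub>v d" and nb: "lanczos_no_breakdown A v m"
begin

lemma lanczos_vec_orthonormal':
  "i < m \<Longrightarrow> j < m \<Longrightarrow> lanczos_vec A v i \<bullet> lanczos_vec A v j = (if i = j then 1 else 0)"
  using nb lanczos_vec_orthonormal[OF sym v0, of "m - 1" i j]
  by (auto simp: lanczos_no_breakdown_def)

lemma lanczos_Q_orthonormal: "(lanczos_Q A v m)\<^sup>T * lanczos_Q A v m = 1\<^sub>m m"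
  using lanczos_Q_carrier[of m]
  by (intro eq_matI) (auto simp: col_lanczos_Q lanczos_vec_orthonormal')

lemma lanczos_T_eq: "lanczos_T A v m = (lanczos_Q A v m)\<^sup>T * A * lanczos_Q A v m"
proof (rule eq_matI)
  let ?Q = "lanczos_Q A v m"
  have Q: "?Q \<in> carrier_mat d m"
    by (rule lanczos_Q_carrier)
  fix i j assume "i < dim_row (?Q\<^sup>T * A * ?Q)" "j < dim_col (?Q\<^sup>T * A * ?Q)"
  then have ij: "i < m" "j < m"
    using Q by auto
  have "(?Q\<^sup>T * A * ?Q) $$ (i, j) = lanczos_vec A v i \<bullet> (A *\<^sub>v lanczos_vec A v j)"
    using Q A ij by (simp add: mult_assoc_dim col_lanczos_Q col_mult2[of A d d ?Q m] mult_mat_vec_def)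
  also have "\<dots> = lanczos_T A v m $$ (i, j)"
  proof (cases "Suc j < m")
    case True
    then show ?thesis
      using ij v scalar_prod_lanczos_recurrence[of "lanczos_vec A v i" j]
      by (cases j) (auto simp: lanczos_T_def lanczos_vec_orthonormal')
  next
    \<comment> \<open>In the last column, \<open>j = m - 1\<close>, the next vector lies outside
      \<open>Q\<close> and may be zero, so its orthogonality is used only after multiplication by
      the coefficient.\<close>
    case False
    have "lanczos_beta A v (Suc j) * (lanczos_vec A v i \<bullet> lanczos_vec A v (Suc j)) = 0"
      using ij False by (intro lanczos_vec_orthogonal_next sym lanczos_vec_orthonormal') auto
    moreover have "lanczos_beta A v j * (lanczos_vec A v i \<bullet> lanczos_prev A v j) =
        (if j = Suc i then lanczos_beta A v j else 0)"
      using ij by (cases j) (auto simp: lanczos_vec_orthonormal')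
    ultimately show ?thesis
      using ij False scalar_prod_lanczos_recurrence[of "lanczos_vec A v i" j]
      by (auto simp: lanczos_T_def lanczos_vec_orthonormal' simp del: mult_eq_0_iff)
  qed
  finally show "lanczos_T A v m $$ (i, j) = (?Q\<^sup>T * A * ?Q) $$ (i, j)" ..
qed (use lanczos_Q_carrier[of m] in \<open>auto simp: lanczos_T_def\<close>)

text \<open>Columns of \<open>Qp\<close> annihilate the first \<open>m\<close> Lanczos vectors, so
  the recurrence leaves only its last summand, and only in the last column of \<open>Q\<close>.
  There the next vector is the first column of \<open>Qp\<close>, unless the coefficient is zero and
  the block vanishes; hence the conditional premise \<open>first\<close>.\<close>

lemma lanczos_coupling_block:
  assumes Qp: "Qp \<in> carrier_mat d k" "Qp\<^sup>T * Qp = 1\<^sub>m k" "(lanczos_Q A v m)\<^sup>T * Qp = 0\<^sub>m m k"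
    and m: "0 < m" and k: "0 < k"
    and first: "lanczos_beta A v m \<noteq> 0 \<Longrightarrow> col Qp 0 = lanczos_vec A v m"
  shows "Qp\<^sup>T * A * lanczos_Q A v m =
    lanczos_beta A v m \<cdot>\<^sub>m outer_prod (unit_vec k 0) (unit_vec m (m - 1))"
proof (rule eq_matI)
  let ?Q = "lanczos_Q A v m"
  have Q: "?Q \<in> carrier_mat d m"
    by (rule lanczos_Q_carrier)
  let ?B = "lanczos_beta A v m \<cdot>\<^sub>m outer_prod (unit_vec k 0) (unit_vec m (m - 1)) :: real mat"
  fix r j assume "r < dim_row ?B" "j < dim_col ?B"
  then have rj: "r < k" "j < m"
    by auto
  have colr: "col Qp r \<in> carrier_vec d"
    using Qp by auto
  have perp: "col Qp r \<bullet> lanczos_vec A v i = 0" if "i < m" for i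
  proof -
    have "lanczos_vec A v i \<bullet> col Qp r = ((?Q)\<^sup>T * Qp) $$ (i, r)"
      using Q Qp(1) that rj by (simp add: col_lanczos_Q)
    then show ?thesis
      using Qp(3) rj that colr by (simp add: comm_scalar_prod[of "col Qp r" d])
  qed
  have "(Qp\<^sup>T * A * ?Q) $$ (r, j) = col Qp r \<bullet> (A *\<^sub>v lanczos_vec A v j)"
    using Q A Qp(1) rj by (simp add: mult_assoc_dim col_lanczos_Q col_mult2[of A d d ?Q m] mult_mat_vec_def)
  also have "\<dots> = lanczos_beta A v (Suc j) * (col Qp r \<bullet> lanczos_vec A v (Suc j))"
    using scalar_prod_lanczos_recurrence[OF colr, of j] perp[OF rj(2)] perp[of "j - 1"] rj v colr
    by (cases j) auto
  also have "\<dots> = ?B $$ (r, j)"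
  proof (cases "Suc j = m")
    case True
    have "lanczos_beta A v m * (col Qp r \<bullet> lanczos_vec A v m)
        = lanczos_beta A v m * (col Qp r \<bullet> col Qp 0)"
      using first by (cases "lanczos_beta A v m = 0") auto
    also have "col Qp r \<bullet> col Qp 0 = (Qp\<^sup>T * Qp) $$ (r, 0)"
      using Qp(1) rj k by simp
    also have "\<dots> = (if r = 0 then 1 else 0)"
      using Qp(2) rj k by simp
    finally show ?thesis
      using True rj by (auto simp: outer_prod_def)
  next
    case False
    then show ?thesis
      using rj perp[of "Suc j"] by (auto simp: outer_prod_def)
  qed
  finally show "(Qp\<^sup>T * A * ?Q) $$ (r, j) = ?B $$ (r, j)" .
qed (use lanczos_Q_carrier[of m] Qp in auto)

end

end

section \<open>Orthogonal splitting and the Schur complement\<close>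

text \<open>For the second claim, \<open>P x\<close> is orthogonal to the range of \<open>Q\<close>,
  so projecting it with \<open>Qp * Qp\<^sup>T\<close> changes nothing; and
  \<open>Qp\<^sup>T * P = Qp\<^sup>T\<close>.\<close>

lemma orthonormal_complement_projection:
  assumes Q: "Q \<in> carrier_mat d m" "Q\<^sup>T * Q = 1\<^sub>m m"
    and Qp: "orthonormal_basis_mat d k Qp (orth_compl d (col_range d Q))"
  shows "Q\<^sup>T * Qp = 0\<^sub>m m k" "Qp * Qp\<^sup>T = 1\<^sub>m d - Q * Q\<^sup>T"
proof -
  have Qp': "Qp \<in> carrier_mat d k" "Qp\<^sup>T * Qp = 1\<^sub>m k"
    and range: "col_range d Qp = orth_compl d (col_range d Q)"
    using Qp by (auto simp: orthonormal_basis_mat_def)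
  have dims [simp]: "dim_row Q = d" "dim_col Q = m" "dim_row Qp = d" "dim_col Qp = k"
    using Q Qp' by auto
  have cancel: "Q\<^sup>T * (Q * X) = X" if "dim_row X = m" for X
    using that Q by (metis mult_assoc_dim left_mult_one_mat carrier_matI dims index_transpose_mat(3))
  have compl_iff: "w \<in> orth_compl d (col_range d Q) \<longleftrightarrow>
      w \<in> carrier_vec d \<and> (\<forall>z\<in>carrier_vec m. w \<bullet> (Q *\<^sub>v z) = 0)" for w
    using mem_col_range_iff[OF Q(1)] by (auto simp: vec_module.orthogonal_complement_def)
  show QtQp: "Q\<^sup>T * Qp = 0\<^sub>m m k"
  proof (rule mat_eq_by_vecI)
    fix x :: "real vec" assume x: "x \<in> carrier_vec k"
    \<comment> \<open>Testing the orthogonality of \<open>Qp x\<close> against \<open>Q z\<close>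
      with this \<open>z\<close> gives \<open>z \<bullet> z = 0\<close>.\<close>
    define z where "z = Q\<^sup>T *\<^sub>v (Qp *\<^sub>v x)"
    have "Qp *\<^sub>v x \<in> orth_compl d (col_range d Q)"
      using x mem_col_range_iff[OF Qp'(1)] range by auto
    then have "(Qp *\<^sub>v x) \<bullet> (Q *\<^sub>v z) = 0"
      by (auto simp: compl_iff z_def intro!: carrier_vecI)
    then have "z \<bullet> z = 0"
      by (simp add: scalar_prod_mult_mat_vec z_def)
    then show "(Q\<^sup>T * Qp) *\<^sub>v x = 0\<^sub>m m k *\<^sub>v x"
      using x by (auto simp: scalar_prod_self_eq_0_iff mult_vec_assoc_dim z_def)
  qed (auto intro: carrier_matI)
  define P where "P = 1\<^sub>m d - Q * Q\<^sup>T"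
  have [simp]: "dim_row P = d" "dim_col P = d"
    by (auto simp: P_def)
  have "(Q\<^sup>T * Qp)\<^sup>T = 0\<^sub>m k m"
    by (simp add: QtQp)
  then have QptQ: "Qp\<^sup>T * Q = 0\<^sub>m k m"
    by (simp add: transpose_mult_dim)
  have "Qp\<^sup>T * P = Qp\<^sup>T - Qp\<^sup>T * Q * Q\<^sup>T"
    by (simp add: P_def mult_minus_dim mult_assoc_dim right_mult_one_mat')
  also have "\<dots> = Qp\<^sup>T"
    unfolding QptQ by (rule eq_matI) auto
  finally have QptP: "Qp\<^sup>T * P = Qp\<^sup>T" .
  have "Q\<^sup>T * P = 0\<^sub>m m d"
    by (auto simp: P_def mult_minus_dim cancel right_mult_one_mat' intro!: eq_matI)
  have "P = Qp * Qp\<^sup>T"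
  proof (rule mat_eq_by_vecI)
    fix x :: "real vec" assume x: "x \<in> carrier_vec d"
    have "P *\<^sub>v x \<in> orth_compl d (col_range d Q)"
      unfolding compl_iff
    proof safe
      fix z :: "real vec" assume z: "z \<in> carrier_vec m"
      have "(P *\<^sub>v x) \<bullet> (Q *\<^sub>v z) = ((Q\<^sup>T * P) *\<^sub>v x) \<bullet> z"
        using x z by (simp add: scalar_prod_mult_mat_vec mult_vec_assoc_dim)
      moreover have "0\<^sub>m m d *\<^sub>v x = 0\<^sub>v m"
        using x by (intro eq_vecI) auto
      ultimately show "(P *\<^sub>v x) \<bullet> (Q *\<^sub>v z) = 0"
        using z by (simp add: \<open>Q\<^sup>T * P = 0\<^sub>m m d\<close>)
    qed (auto intro: carrier_vecI)
    then have "Qp *\<^sub>v (Qp\<^sup>T *\<^sub>v (P *\<^sub>v x)) = P *\<^sub>v x"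
      by (rule orthonormal_basis_mat_project[OF Qp])
    also have "Qp\<^sup>T *\<^sub>v (P *\<^sub>v x) = Qp\<^sup>T *\<^sub>v x"
      using x by (simp flip: mult_vec_assoc_dim add: QptP)
    finally show "P *\<^sub>v x = (Qp * Qp\<^sup>T) *\<^sub>v x"
      using x by (simp add: mult_vec_assoc_dim)
  qed (auto intro: carrier_matI)
  then show "Qp * Qp\<^sup>T = 1\<^sub>m d - Q * Q\<^sup>T"
    by (simp add: P_def)
qed

text \<open>Block elimination in the basis \<open>[Q, Qp]\<close>: \<open>X\<close> is the
  off-diagonal block of \<open>A'\<close>. The block row of \<open>Q\<close> expresses
  \<open>X\<close> through the block \<open>Qp\<^sup>T * A' * Qp\<close>, and substitution into the
  row of \<open>Qp\<close> cancels the two terms in \<open>X\<close>.\<close>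

lemma schur_complement_inverse:
  fixes A :: "'a::comm_ring_1 mat"
  assumes A: "A \<in> carrier_mat d d" and A': "A' \<in> carrier_mat d d" "A * A' = 1\<^sub>m d"
    and Q: "Q \<in> carrier_mat d m" and Qp: "Qp \<in> carrier_mat d k"
    and orth: "Q\<^sup>T * Qp = 0\<^sub>m m k" "Qp\<^sup>T * Qp = 1\<^sub>m k" "Qp * Qp\<^sup>T = 1\<^sub>m d - Q * Q\<^sup>T"
    and T': "T' \<in> carrier_mat m m" "T' * (Q\<^sup>T * A * Q) = 1\<^sub>m m"
  shows "(Qp\<^sup>T * A * Qp - Qp\<^sup>T * A * Q * T' * (Q\<^sup>T * A * Qp)) * (Qp\<^sup>T * A' * Qp) = 1\<^sub>m k"
proof -
  have dims [simp]: "dim_row A = d" "dim_col A = d" "dim_row A' = d" "dim_col A' = d"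
    "dim_row Q = d" "dim_col Q = m" "dim_row Qp = d" "dim_col Qp = k"
    "dim_row T' = m" "dim_col T' = m"
    using assms by auto
  define X where "X = Q\<^sup>T * A' * Qp"
  have [simp]: "dim_row X = m" "dim_col X = k"
    by (simp_all add: X_def)
  have AA': "A * (A' * Z) = Z" if "dim_row Z = d" for Z
    using that A'(2) by (metis mult_assoc_dim left_mult_one_mat carrier_matI dims(2-4))
  have proj: "Qp * (Qp\<^sup>T * Z) = Z - Q * (Q\<^sup>T * Z)" if "dim_row Z = d" for Z
  proof -
    have "Qp * (Qp\<^sup>T * Z) = (1\<^sub>m d - Q * Q\<^sup>T) * Z"
      using that by (simp flip: orth(3) add: mult_assoc_dim)
    then show ?thesis
      using that by (simp add: minus_mult_dim mult_assoc_dim left_mult_one_mat')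
  qed
  \<comment> \<open>One block row of \<open>A * A' = 1\<close> against the columns of
    \<open>Qp\<close>, after replacing \<open>Qp * Qp\<^sup>T\<close> by
    \<open>1 - Q * Q\<^sup>T\<close>. It is used for \<open>U = Qp\<close> and for
    \<open>U = Q\<close>.\<close>
  have cancel: "U\<^sup>T * A * Qp * (Qp\<^sup>T * A' * Qp) = U\<^sup>T * Qp - U\<^sup>T * A * Q * X"
    if "dim_row U = d" for U
    using that by (simp add: mult_assoc_dim proj mult_minus_dim AA' X_def)
  have T'T: "T' * (Q\<^sup>T * A * Q * X) = X"
    using T' by (simp flip: mult_assoc_dim[of T' "Q\<^sup>T * A * Q" X] add: left_mult_one_mat')
  have "(Qp\<^sup>T * A * Qp - Qp\<^sup>T * A * Q * T' * (Q\<^sup>T * A * Qp)) * (Qp\<^sup>T * A' * Qp)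
      = Qp\<^sup>T * A * Qp * (Qp\<^sup>T * A' * Qp)
        - Qp\<^sup>T * A * Q * (T' * (Q\<^sup>T * A * Qp * (Qp\<^sup>T * A' * Qp)))"
    by (simp add: minus_mult_dim mult_assoc_dim)
  also have "\<dots> = 1\<^sub>m k - Qp\<^sup>T * A * Q * X - Qp\<^sup>T * A * Q * (T' * (0\<^sub>m m k - Q\<^sup>T * A * Q * X))"
    by (simp only: cancel dims orth(1,2))
  also have "T' * (0\<^sub>m m k - Q\<^sup>T * A * Q * X) = - X"
    using T'(1) by (simp add: mult_minus_dim T'T) (auto intro!: eq_matI)
  also have "Qp\<^sup>T * A * Q * (- X) = - (Qp\<^sup>T * A * Q * X)"
    by simp
  also have "1\<^sub>m k - Qp\<^sup>T * A * Q * X - - (Qp\<^sup>T * A * Q * X) = 1\<^sub>m k"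
    by (rule eq_matI) auto
  finally show ?thesis .
qed

section \<open>Compression to the complement of a direction\<close>

context
  fixes Qp :: "real mat" and y :: "real vec" and W and d k :: nat
  assumes Qp: "Qp \<in> carrier_mat d k" "Qp\<^sup>T * Qp = 1\<^sub>m k"
    and y: "y \<in> carrier_vec k" "y \<bullet> y = 1"
  defines "W \<equiv> {w \<in> col_range d (Qp * Qp\<^sup>T). w \<bullet> (Qp *\<^sub>v y) = 0}"
begin

private lemma dims: "dim_row Qp = d" "dim_col Qp = k" "dim_vec y = k"
  using Qp y by auto

private lemmas cancel = orthonormal_cancel[OF Qp]

text \<open>\<open>Qp\<close> is an isometry onto the range of \<open>Qp * Qp\<^sup>T\<close>, so
  the condition on \<open>W\<close> can be checked on coordinate vectors of length
  \<open>k\<close>.\<close>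

private lemma mem_complement_iff: "w \<in> W \<longleftrightarrow> (\<exists>z\<in>carrier_vec k. w = Qp *\<^sub>v z \<and> z \<bullet> y = 0)"
proof -
  note [simp] = dims
  have "w \<in> col_range d (Qp * Qp\<^sup>T) \<longleftrightarrow> (\<exists>z\<in>carrier_vec k. w = Qp *\<^sub>v z)"
  proof -
    have PP: "Qp * Qp\<^sup>T \<in> carrier_mat d d"
      by (auto intro: carrier_matI)
    have "Qp *\<^sub>v z = Qp * Qp\<^sup>T *\<^sub>v (Qp *\<^sub>v z)" "Qp *\<^sub>v z \<in> carrier_vec d" if "z \<in> carrier_vec k" for z
      using that cancel[OF that] by (auto simp: mult_vec_assoc_dim intro: carrier_vecI)
    moreover have "Qp * Qp\<^sup>T *\<^sub>v x = Qp *\<^sub>v (Qp\<^sup>T *\<^sub>v x)" "Qp\<^sup>T *\<^sub>v x \<in> carrier_vec k"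
      if "x \<in> carrier_vec d" for x
      using that by (auto simp: mult_vec_assoc_dim intro: carrier_vecI)
    ultimately show ?thesis
      unfolding mem_col_range_iff[OF PP] by metis
  qed
  moreover have "(Qp *\<^sub>v z) \<bullet> (Qp *\<^sub>v y) = z \<bullet> y" if "z \<in> carrier_vec k" for z
    using that by (simp add: scalar_prod_mult_mat_vec cancel)
  ultimately show ?thesis
    unfolding W_def by auto
qed

text \<open>The Householder columns \<open>Z\<close> span the complement of \<open>y\<close> in
  coordinates, and \<open>Qp\<close> transports them isometrically to \<open>W\<close>.\<close>

lemma ex_orthonormal_basis_mat_complement: "0 < k \<Longrightarrow> \<exists>V. orthonormal_basis_mat d (k - 1) V W"
proof -
  note [simp] = dims
  assume "0 < k"
  then obtain Z where Z: "Z \<in> carrier_mat k (k - 1)" "Z\<^sup>T * Z = 1\<^sub>m (k - 1)"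
    "Z * Z\<^sup>T = 1\<^sub>m k - outer_prod y y"
    using ex_orthonormal_complement[OF y] by blast
  have [simp]: "dim_row Z = k" "dim_col Z = k - 1"
    using Z by auto
  have ZZt: "Z *\<^sub>v (Z\<^sup>T *\<^sub>v x) = x - (y \<bullet> x) \<cdot>\<^sub>v y" if "x \<in> carrier_vec k" for x
    using that by (simp flip: mult_vec_assoc_dim add: Z(3))
      (simp add: minus_mult_vec_dim outer_prod_mult_vec)
  \<comment> \<open>Inserting \<open>Z\<^sup>T * Z = 1\<close> in front produces
    \<open>Z * Z\<^sup>T\<close> applied to \<open>y\<close>, which is zero because \<open>y\<close>
    is a unit vector.\<close>
  have "Z\<^sup>T *\<^sub>v y = (Z\<^sup>T * Z) *\<^sub>v (Z\<^sup>T *\<^sub>v y)"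
    unfolding Z(2) by (auto intro!: one_mult_mat_vec[symmetric] carrier_vecI)
  also have "\<dots> = Z\<^sup>T *\<^sub>v (Z *\<^sub>v (Z\<^sup>T *\<^sub>v y))"
    by (simp add: mult_vec_assoc_dim)
  also have "Z *\<^sub>v (Z\<^sup>T *\<^sub>v y) = 0\<^sub>v k"
    using y by (auto simp: ZZt)
  finally have Zty: "Z\<^sup>T *\<^sub>v y = 0\<^sub>v (k - 1)"
    using Z by (auto intro!: eq_vecI)
  define V where "V = Qp * Z"
  have V: "V \<in> carrier_mat d (k - 1)"
    by (auto simp: V_def intro: carrier_matI)
  have "V\<^sup>T * V = Z\<^sup>T * (Qp\<^sup>T * Qp * Z)"
    by (simp add: V_def mat_algebra_dim)
  also have "\<dots> = 1\<^sub>m (k - 1)"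
    by (simp add: Qp Z(2) left_mult_one_mat')
  finally have VtV: "V\<^sup>T * V = 1\<^sub>m (k - 1)" .
  have "w \<in> col_range d V \<longleftrightarrow> w \<in> W" for w
  proof
    assume "w \<in> col_range d V"
    then obtain x where x: "x \<in> carrier_vec (k - 1)" "w = Qp *\<^sub>v (Z *\<^sub>v x)"
      using mem_col_range_iff[OF V] by (auto simp: V_def mult_vec_assoc_dim)
    have "(Z *\<^sub>v x) \<bullet> y = y \<bullet> (Z *\<^sub>v x)"
      using y Z x by (intro comm_scalar_prod) auto
    also have "\<dots> = 0"
      using x by (simp add: scalar_prod_mult_mat_vec Zty)
    finally have "(Z *\<^sub>v x) \<bullet> y = 0" .
    moreover have "Z *\<^sub>v x \<in> carrier_vec k"
      using x Z by auto
    ultimately show "w \<in> W"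
      unfolding mem_complement_iff using x(2) by blast
  next
    assume "w \<in> W"
    then obtain z where z: "z \<in> carrier_vec k" "w = Qp *\<^sub>v z" "z \<bullet> y = 0"
      unfolding mem_complement_iff by auto
    then have "y \<bullet> z = 0"
      using comm_scalar_prod[OF y(1) z(1)] by simp
    then have "Z *\<^sub>v (Z\<^sup>T *\<^sub>v z) = z"
      using z by (auto simp: ZZt intro!: eq_vecI)
    then have "w = V *\<^sub>v (Z\<^sup>T *\<^sub>v z)"
      using z by (simp add: V_def mult_vec_assoc_dim)
    then show "w \<in> col_range d V"
      using mem_col_range_iff[OF V] by (auto intro!: bexI[of _ "Z\<^sup>T *\<^sub>v z"] carrier_vecI)
  qed
  then have "orthonormal_basis_mat d (k - 1) V W"
    using V VtV by (auto simp: orthonormal_basis_mat_def)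
  then show ?thesis ..
qed

text \<open>In coordinates the basis becomes \<open>G\<close>, with
  \<open>G * G\<^sup>T = 1 - y y^T\<close>. Cyclicity of the trace then removes the dependence on
  the chosen basis.\<close>

lemma mat_trace_compression_complement:
  assumes V: "orthonormal_basis_mat d l V W" and B: "B \<in> carrier_mat k k"
  shows "mat_trace (V\<^sup>T * (Qp * B * Qp\<^sup>T) * V) = mat_trace B - y \<bullet> (B *\<^sub>v y)"
proof -
  note [simp] = dims
  have V': "V \<in> carrier_mat d l" "col_range d V = W"
    using V by (auto simp: orthonormal_basis_mat_def)
  have [simp]: "dim_row V = d" "dim_col V = l" "dim_row B = k" "dim_col B = k"
    using V' B by auto
  have Vtu: "V\<^sup>T *\<^sub>v (Qp *\<^sub>v y) = 0\<^sub>v l"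
  proof -
    define z where "z = V\<^sup>T *\<^sub>v (Qp *\<^sub>v y)"
    have z: "z \<in> carrier_vec l"
      by (auto simp: z_def intro: carrier_vecI)
    then have "V *\<^sub>v z \<in> W"
      using V' mem_col_range_iff[OF V'(1)] by auto
    then have "(V *\<^sub>v z) \<bullet> (Qp *\<^sub>v y) = 0"
      by (simp add: W_def)
    then have "(Qp *\<^sub>v y) \<bullet> (V *\<^sub>v z) = 0"
      by (subst comm_scalar_prod[of _ d]) (auto intro: carrier_vecI)
    then have "z \<bullet> z = 0"
      using z by (simp add: scalar_prod_mult_mat_vec z_def)
    then show ?thesis
      using z by (simp add: scalar_prod_self_eq_0_iff z_def)
  qed
  define G where "G = Qp\<^sup>T * V"
  have [simp]: "dim_row G = k" "dim_col G = l"
    by (auto simp: G_def)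
  have GGt: "G * G\<^sup>T = 1\<^sub>m k - outer_prod y y"
  proof (rule mat_eq_by_vecI)
    fix x :: "real vec" assume x: "x \<in> carrier_vec k"
    \<comment> \<open>The part of \<open>x\<close> along \<open>y\<close> is invisible to the
      transpose of \<open>V\<close> by \<open>Vtu\<close>, while \<open>Qp x'\<close> lies in
      \<open>W\<close> and is fixed by \<open>V * V\<^sup>T\<close>.\<close>
    define x' where "x' = x - (y \<bullet> x) \<cdot>\<^sub>v y"
    have x': "x' \<in> carrier_vec k"
      using x y by (auto simp: x'_def)
    have "x' \<bullet> y = 0"
      using x y by (simp add: x'_def minus_scalar_prod_distrib[of _ k] comm_scalar_prod[of x k y])
    then have mem: "Qp *\<^sub>v x' \<in> W"
      using x' mem_complement_iff by auto
    have "V\<^sup>T *\<^sub>v (Qp *\<^sub>v x') = V\<^sup>T *\<^sub>v (Qp *\<^sub>v x) - (y \<bullet> x) \<cdot>\<^sub>v (V\<^sup>T *\<^sub>v (Qp *\<^sub>v y))"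
      using x y V' Qp by (simp add: x'_def mult_minus_distrib_mat_vec[of _ _ k] mult_minus_distrib_mat_vec[of _ _ d]
          mult_mat_vec_smult_dim)
    also have "\<dots> = V\<^sup>T *\<^sub>v (Qp *\<^sub>v x)"
      unfolding Vtu by (rule eq_vecI) auto
    finally have "V\<^sup>T *\<^sub>v (Qp *\<^sub>v x) = V\<^sup>T *\<^sub>v (Qp *\<^sub>v x')" ..
    then have "(G * G\<^sup>T) *\<^sub>v x = Qp\<^sup>T *\<^sub>v (V *\<^sub>v (V\<^sup>T *\<^sub>v (Qp *\<^sub>v x')))"
      using x by (simp add: G_def mat_algebra_dim)
    also have "\<dots> = x'"
      using x' by (simp add: orthonormal_basis_mat_project[OF V mem] cancel)
    finally show "(G * G\<^sup>T) *\<^sub>v x = (1\<^sub>m k - outer_prod y y) *\<^sub>v x"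
      using x by (simp add: x'_def minus_mult_vec_dim outer_prod_mult_vec)
  qed (auto intro: carrier_matI)
  have "mat_trace (V\<^sup>T * (Qp * B * Qp\<^sup>T) * V) = mat_trace (G\<^sup>T * (B * G))"
    by (simp add: G_def mat_algebra_dim)
  also have "\<dots> = mat_trace (B * G * G\<^sup>T)"
    by (intro mat_trace_comm[of _ l k]) (auto intro: carrier_matI)
  also have "B * G * G\<^sup>T = B - outer_prod (B *\<^sub>v y) y"
    by (simp add: mult_assoc_dim GGt mult_minus_dim mult_outer_prod right_mult_one_mat')
  also have "mat_trace \<dots> = mat_trace B - (B *\<^sub>v y) \<bullet> y"
    by (subst mat_trace_minus[of _ k]) (auto simp: mat_trace_outer_prod intro: carrier_matI)
  also have "(B *\<^sub>v y) \<bullet> y = y \<bullet> (B *\<^sub>v y)"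
    by (intro comm_scalar_prod[of _ k]) (auto intro: carrier_vecI)
  finally show ?thesis .
qed

end

section \<open>The Schur complement, the compressed residual and the bulk mean\<close>

theorem lemma7:
  fixes d m :: nat
    and A Q T Qp P Tp S f R M :: "real mat"
    and v_ref q_next e1 q_perp u :: "real vec"
    and \<beta> \<gamma> \<sigma> :: real
  assumes A: "sym_pos_def d A"
    and m: "1 \<le> m" "m < d"
    and v_ref: "v_ref \<in> carrier_vec d" "v_ref \<noteq> 0\<^sub>v d"
    and no_breakdown: "lanczos_no_breakdown A v_ref m"
    and Q: "Q = lanczos_Q A v_ref m"
    and T: "T = lanczos_T A v_ref m"
    and \<beta>: "\<beta> = lanczos_beta A v_ref m"
    and q_next: "lanczos_next A v_ref m q_next"
    and Qp: "orthonormal_basis_mat d (d - m) Qp (orth_compl d (col_range d Q))"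
    and Qp_first: "col Qp 0 = q_next"
    and P: "P = 1\<^sub>m d - Q * Q\<^sup>T"
    and Tp: "Tp = Qp\<^sup>T * A * Qp"
    and e1: "e1 = unit_vec (d - m) 0"
    and \<gamma>: "\<gamma> = \<beta>\<^sup>2 * mat_inv T $$ (m - 1, m - 1)"
    and S: "S = Tp - \<gamma> \<cdot>\<^sub>m outer_prod e1 e1"
    and f: "f = Q * mat_inv T * Q\<^sup>T"
    and R: "R = mat_inv A - f"
    and M: "M = Qp * mat_inv S * Qp\<^sup>T"
    and q_perp: "q_perp = Qp *\<^sub>v (mat_inv S *\<^sub>v e1)"
    and u: "u = (1 / vec_norm2 q_perp) \<cdot>\<^sub>v q_perp"
    and \<sigma>: "\<sigma> = u \<bullet> (M *\<^sub>v u)"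
  shows
    \<comment> \<open>the inverses of T and S are meaningful\<close>
    "sym_pos_def m T \<and> sym_pos_def (d - m) S \<and>
     \<comment> \<open>(i)\<close>
     P * f = 0\<^sub>m d d \<and> P * f * P = 0\<^sub>m d d \<and>
     \<comment> \<open>(ii)\<close>
     Qp\<^sup>T * mat_inv A * Qp = mat_inv S \<and>
     P * R * P = M \<and>
     mat_trace (P * R * P) = mat_trace (mat_inv S) \<and>
     \<comment> \<open>(iii); the matrix of the compression of M to W in an orthonormal basis V of W is \<open>V\<^sup>T * M * V\<close>\<close>
     \<sigma> = (e1 \<bullet> ((mat_inv S ^\<^sub>m 3) *\<^sub>v e1)) / (e1 \<bullet> ((mat_inv S ^\<^sub>m 2) *\<^sub>v e1)) \<and>
     (d - m \<ge> 2 \<longrightarrow>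
       (let W = {w \<in> col_range d P. w \<bullet> u = 0} in
         (\<exists>V. orthonormal_basis_mat d (d - m - 1) V W) \<and>
         (\<forall>V. orthonormal_basis_mat d (d - m - 1) V W \<longrightarrow>
            size (eigenvalue_mset (V\<^sup>T * M * V)) = d - m - 1 \<and>
            sum_mset (eigenvalue_mset (V\<^sup>T * M * V)) / real (d - m - 1)
              = (mat_trace (mat_inv S) - \<sigma>) / real (d - m - 1))))"
proof -
  let ?k = "d - m"
  have Ac: "A \<in> carrier_mat d d" and symA: "A\<^sup>T = A"
    using A by (auto simp: sym_pos_def_def)
  have k: "0 < ?k"
    using m by simp
  have Qc: "Q \<in> carrier_mat d m" and QtQ: "Q\<^sup>T * Q = 1\<^sub>m m" and T_eq: "T = Q\<^sup>T * A * Q"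
    unfolding Q T
    using lanczos_Q_carrier[OF Ac v_ref(1)] lanczos_Q_orthonormal[OF Ac v_ref(1) symA v_ref(2) no_breakdown]
      lanczos_T_eq[OF Ac v_ref(1) symA v_ref(2) no_breakdown]
    by auto
  have Qpc: "Qp \<in> carrier_mat d ?k" and QptQp: "Qp\<^sup>T * Qp = 1\<^sub>m ?k"
    using Qp by (auto simp: orthonormal_basis_mat_def)
  have dims [simp]: "dim_row A = d" "dim_col A = d" "dim_row Q = d" "dim_col Q = m"
    "dim_row Qp = d" "dim_col Qp = ?k"
    using Ac Qc Qpc by auto
  note split = orthonormal_complement_projection[OF Qc QtQ Qp]
  have P_eq: "P = Qp * Qp\<^sup>T"
    by (simp add: P split(2))
  have posT: "sym_pos_def m T"
    unfolding T_eq using A Qc QtQ by (rule sym_pos_def_compression)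
  obtain Ti where Ti: "Ti \<in> carrier_mat m m" "Ti * T = 1\<^sub>m m" "mat_inv T = Ti"
    using sym_pos_def_inverse[OF posT] by metis
  obtain Ai where Ai: "Ai \<in> carrier_mat d d" "A * Ai = 1\<^sub>m d" "mat_inv A = Ai" "sym_pos_def d Ai"
    using sym_pos_def_inverse[OF A] by metis
  have dims' [simp]: "dim_row Ti = m" "dim_col Ti = m" "dim_row Ai = d" "dim_col Ai = d"
    using Ti Ai by auto
  \<comment> \<open>The candidate for the inverse of \<open>S\<close>. Its positivity is inherited
    from the inverse of \<open>A\<close> and is later passed on to \<open>S\<close>.\<close>
  define B where "B = Qp\<^sup>T * Ai * Qp"
  have posB: "sym_pos_def ?k B"
    unfolding B_def using Ai(4) Qpc QptQp by (rule sym_pos_def_compression)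
  have Bc: "B \<in> carrier_mat ?k ?k" and symB: "B\<^sup>T = B"
    using posB by (auto simp: sym_pos_def_def)
  have dimB [simp]: "dim_row B = ?k" "dim_col B = ?k"
    using Bc by auto
  have e1_dim [simp]: "dim_vec e1 = ?k"
    by (simp add: e1)

  have first: "col Qp 0 = lanczos_vec A v_ref m" if "lanczos_beta A v_ref m \<noteq> 0"
    using q_next Qp_first that by (simp add: lanczos_next_def)
  define em :: "real vec" where "em = unit_vec m (m - 1)"
  have [simp]: "dim_vec em = m"
    by (simp add: em_def)
  have "Qp\<^sup>T * A * Q = \<beta> \<cdot>\<^sub>m outer_prod e1 em"
    unfolding Q \<beta> e1 em_def using m(1) k
    by (intro lanczos_coupling_block[OF Ac v_ref(1) symA v_ref(2) no_breakdown Qpc QptQp _ _ _ first])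
      (simp_all add: split(1)[unfolded Q])
  then have F: "Qp\<^sup>T * A * Q = outer_prod (\<beta> \<cdot>\<^sub>v e1) em"
    by (auto simp: outer_prod_def intro!: eq_matI)
  have "Q\<^sup>T * A * Qp = (Qp\<^sup>T * A * Q)\<^sup>T"
    by (simp add: transpose_mult_dim symA mult_assoc_dim)
  also have "\<dots> = outer_prod em (\<beta> \<cdot>\<^sub>v e1)"
    by (simp add: F)
  finally have G: "Q\<^sup>T * A * Qp = outer_prod em (\<beta> \<cdot>\<^sub>v e1)" .
  have "(Ti\<^sup>T *\<^sub>v em) \<bullet> em = Ti $$ (m - 1, m - 1)"
    using m(1) Ti(1) by (simp add: em_def)
  \<comment> \<open>Both coupling blocks have rank at most one, so the Schur correction involves
    \<open>T^{-1}\<close> only through its last diagonal entry, at index \<open>m - 1\<close> when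
    counting from 0.\<close>
  then have "Qp\<^sup>T * A * Q * Ti * (Q\<^sup>T * A * Qp) = \<gamma> \<cdot>\<^sub>m outer_prod e1 e1"
    unfolding F G by (simp add: \<gamma> Ti(3) outer_prod_mult mult_outer_prod outer_prod_mult_vec
        outer_prod_smult smult_smult_assoc power2_eq_square mult_ac)
  then have SB: "S * B = 1\<^sub>m ?k"
    using schur_complement_inverse[OF Ac Ai(1,2) Qc Qpc split(1) QptQp split(2) Ti(1)] Ti(2)
    by (simp add: S Tp B_def T_eq)
  have Sc: "S \<in> carrier_mat ?k ?k"
    by (auto simp: S Tp intro: carrier_matI)
  have invS: "mat_inv S = B"
    using Sc Bc SB by (rule mat_inv_eqI)
  \<comment> \<open>\<open>S\<close> equals the inverse of the positive definite matrix
    \<open>B\<close>.\<close>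
  have posS: "sym_pos_def ?k S"
  proof -
    obtain B' where B': "B' \<in> carrier_mat ?k ?k" "B * B' = 1\<^sub>m ?k" "sym_pos_def ?k B'"
      using sym_pos_def_inverse[OF posB] by metis
    have "S = S * B * B'"
      using Sc Bc B' by (simp add: assoc_mult_mat[of S ?k ?k B ?k B' ?k])
    also have "\<dots> = B'"
      using B' SB by simp
    finally show ?thesis
      using B' by simp
  qed

  have cancelQ: "Q\<^sup>T * (Q * X) = X" if "dim_row X = m" for X
    using that QtQ by (metis mult_assoc_dim left_mult_one_mat carrier_matI dims(3,4) index_transpose_mat(3))
  have cancelQp: "Qp\<^sup>T * (Qp * X) = X" if "dim_row X = ?k" for X
    using that QptQp by (metis mult_assoc_dim left_mult_one_mat carrier_matI dims(5,6) index_transpose_mat(3))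
  have [simp]: "dim_row P = d" "dim_col P = d" "dim_row f = d" "dim_col f = d"
    by (auto simp: P f Ti(3))
  have "P * f = f - f"
    by (simp add: P f Ti(3) minus_mult_dim mult_assoc_dim cancelQ left_mult_one_mat')
  then have Pf: "P * f = 0\<^sub>m d d"
    by (simp add: minus_r_inv_mat[of f d d] carrier_matI)
  then have PfP: "P * f * P = 0\<^sub>m d d"
    by (simp add: left_mult_zero_mat')
  have "P * R * P = P * Ai * P - P * f * P"
    by (simp add: R Ai(3) minus_mult_dim mult_minus_dim)
  also have "\<dots> = P * Ai * P"
    unfolding PfP by (rule eq_matI) auto
  also have "\<dots> = M"
    by (simp add: P_eq M invS B_def mult_assoc_dim)
  finally have PRP: "P * R * P = M" .
  have "mat_trace M = mat_trace (Qp * (B * Qp\<^sup>T))"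
    by (simp add: M invS mult_assoc_dim)
  also have "\<dots> = mat_trace (B * Qp\<^sup>T * Qp)"
    by (intro mat_trace_comm[of _ d ?k]) (auto intro: carrier_matI)
  also have "B * Qp\<^sup>T * Qp = B"
    by (simp add: mult_assoc_dim QptQp right_mult_one_mat')
  finally have trM: "mat_trace M = mat_trace B" .

  \<comment> \<open>\<open>b\<close> and \<open>y\<close> are the coordinates of
    \<open>q_perp\<close> and \<open>u\<close> in the columns of \<open>Qp\<close>.\<close>
  define b where "b = B *\<^sub>v e1"
  define y where "y = (1 / vec_norm2 b) \<cdot>\<^sub>v b"
  have b: "b \<in> carrier_vec ?k"
    by (auto simp: b_def intro: carrier_vecI)
  have y: "y \<in> carrier_vec ?k"
    using b by (simp add: y_def)
  have Mu: "(Qp *\<^sub>v x) \<bullet> (M *\<^sub>v (Qp *\<^sub>v x)) = x \<bullet> (B *\<^sub>v x)" if "x \<in> carrier_vec ?k" for x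
    using that orthonormal_cancel[OF Qpc QptQp] Bc
    by (simp add: M invS mult_vec_assoc_dim scalar_prod_mult_mat_vec)
  have "q_perp \<bullet> q_perp = b \<bullet> b"
    using orthonormal_cancel[OF Qpc QptQp b] b
    by (simp add: q_perp invS b_def[symmetric] scalar_prod_mult_mat_vec)
  then have u_eq: "u = Qp *\<^sub>v y"
    using b by (simp add: u q_perp invS b_def[symmetric] y_def vec_norm2_def mult_mat_vec_smult_dim)
  \<comment> \<open>Since \<open>S b = e1\<close> is nonzero, the normalization of
    \<open>q_perp\<close> never falls into the default \<open>1 / 0 = 0\<close>.\<close>
  have "b \<noteq> 0\<^sub>v ?k"
  proof
    assume "b = 0\<^sub>v ?k"
    moreover have "S *\<^sub>v b = e1"
      using Sc Bc SB by (simp add: b_def flip: mult_vec_assoc_dim) (simp add: e1)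
    ultimately have "e1 = 0\<^sub>v ?k"
      using Sc by (auto intro!: eq_vecI)
    then have "e1 $ 0 = 0"
      using k by simp
    then show False
      using k by (simp add: e1)
  qed
  then have bb: "b \<bullet> b \<noteq> 0"
    using b by (simp add: scalar_prod_self_eq_0_iff)
  have norm_b: "vec_norm2 b * vec_norm2 b = b \<bullet> b"
    by (rule vec_norm2_square)
  have yy: "y \<bullet> y = 1"
    using b bb by (simp add: y_def norm_b)
  have \<sigma>_eq: "\<sigma> = y \<bullet> (B *\<^sub>v y)"
    by (simp add: \<sigma> u_eq Mu y)
  have "\<sigma> = (b \<bullet> (B *\<^sub>v b)) / (b \<bullet> b)"
    unfolding \<sigma>_eq y_def using b Bc by (simp add: mult_mat_vec_smult_dim norm_b)
  \<comment> \<open>Symmetry of \<open>B\<close> lets one factor move to the left \<open>e1\<close>,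
    turning it into \<open>b\<close>; the quotient of powers is thus the Rayleigh quotient of
    \<open>B\<close> at \<open>b\<close>.\<close>
  moreover have "e1 \<bullet> ((B ^\<^sub>m 2) *\<^sub>v e1) = b \<bullet> b"
    by (simp add: numeral_2_eq_2 left_mult_one_mat' mult_vec_assoc_dim scalar_prod_mult_mat_vec symB b_def)
  moreover have "e1 \<bullet> ((B ^\<^sub>m 3) *\<^sub>v e1) = b \<bullet> (B *\<^sub>v b)"
    by (simp add: numeral_3_eq_3 left_mult_one_mat' mult_vec_assoc_dim b_def
        scalar_prod_mult_mat_vec[of e1] symB)
  ultimately have \<sigma>_quot:
    "\<sigma> = (e1 \<bullet> ((mat_inv S ^\<^sub>m 3) *\<^sub>v e1)) / (e1 \<bullet> ((mat_inv S ^\<^sub>m 2) *\<^sub>v e1))"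
    by (simp add: invS)

  define W where "W = {w \<in> col_range d P. w \<bullet> u = 0}"
  have W_eq: "W = {w \<in> col_range d (Qp * Qp\<^sup>T). w \<bullet> (Qp *\<^sub>v y) = 0}"
    by (simp add: W_def P_eq u_eq)
  have exV: "\<exists>V. orthonormal_basis_mat d (?k - 1) V W"
    unfolding W_eq by (rule ex_orthonormal_basis_mat_complement[OF Qpc QptQp y yy k])
  have symM: "M\<^sup>T = M"
    by (simp add: M invS mat_algebra_dim symB)
  have eigs: "size (eigenvalue_mset (V\<^sup>T * M * V)) = ?k - 1"
    "sum_mset (eigenvalue_mset (V\<^sup>T * M * V)) = mat_trace B - \<sigma>"
    if V: "orthonormal_basis_mat d (?k - 1) V W" for V
  proof -
    have [simp]: "dim_row V = d" "dim_col V = ?k - 1" "dim_row M = d" "dim_col M = d"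
      using V by (auto simp: orthonormal_basis_mat_def M)
    have "V\<^sup>T * M * V \<in> carrier_mat (?k - 1) (?k - 1)" "(V\<^sup>T * M * V)\<^sup>T = V\<^sup>T * M * V"
      by (auto simp: mat_algebra_dim symM intro: carrier_matI)
    note eig = eigenvalue_mset_symmetric[OF this]
    show "size (eigenvalue_mset (V\<^sup>T * M * V)) = ?k - 1"
      by (rule eig(1))
    have "mat_trace (V\<^sup>T * M * V) = mat_trace B - y \<bullet> (B *\<^sub>v y)"
      unfolding M invS
      by (rule mat_trace_compression_complement[OF Qpc QptQp y yy V[unfolded W_eq] Bc])
    then show "sum_mset (eigenvalue_mset (V\<^sup>T * M * V)) = mat_trace B - \<sigma>"
      by (simp only: eig(2) \<sigma>_eq)
  qed
  show ?thesis
    unfolding W_def[symmetric] Let_def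
    using posT posS Pf PfP PRP trM \<sigma>_quot exV eigs
    by (simp add: invS Ai(3) B_def[symmetric])
qed

end
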